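(* Let $D = (P, \mathcal{B})$ be a $2$-$(v, k,\lambda)$ design with $b$ blocks and $r$ blocks through each point, and let $G=G_D$ be its incidence graph. Let $m$ be any positive integer. Then for any $X \subseteq P$ and $Y \subseteq \mathcal{B}$, \[ |N(X)| \ge \frac{2rm-\lambda (|X|-1)}{m(m+1)}|X|;\qquad |N(X)| \ge \frac{r^2}{r + \lambda(|X|-1)}|X|; \] \[ |N(Y)| \ge \frac{rk}{r^2-\lambda(b-|Y|)}|Y|;\qquad |N(X) \setminus Y| \ge \frac{4\lambda}{k^2}|X|\,|P \setminus (X \cup N(Y))|. \] Moreover, equality holds in the first inequality if every block in $N(X)$ contains exactly $m$ or $m+1$ points of $X$.
   Context: Given positive integers $v>k>\lambda$, a $2$-$(v,k,\lambda)$ design is a pair $(P,\mathcal{B})$ where $P$ is a set of $v$ points and $\mathcal{B}$ is a set of $k$-subsets of $P$ (blocks) such that every $2$-subset of $P$ is contained in exactly $\lambda$ blocks. The incidence graph $G_D$ is the bipartite graph on $P\cup\mathcal{B}$ with $p$ adjacent to $B$ iff $p\in B$. For $S$ a set of vertices, $N(S)$ denotes the set of vertices not in $S$ adjacent to at least one vertex of $S$ (in $G_D$). *)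

theory Defs
  imports Complex_Main "Graph_Theory.Pair_Digraph"
begin

definition two_design :: "nat \<Rightarrow> nat \<Rightarrow> nat \<Rightarrow> 'a set \<Rightarrow> 'a set set \<Rightarrow> bool" where
  "two_design v k \<Lambda> P Bs \<longleftrightarrow>
     0 < \<Lambda> \<and> \<Lambda> < k \<and> k < v \<and>
     finite P \<and> card P = v \<and>
     (\<forall>B\<in>Bs. B \<subseteq> P \<and> card B = k) \<and>
     (\<forall>S. S \<subseteq> P \<and> card S = 2 \<longrightarrow> card {B \<in> Bs. S \<subseteq> B} = \<Lambda>)"

text \<open>As usual in the Graph Theory library, an undirected graph is a symmetric digraph. The
  vertex set is the disjoint union of the points (\<open>Inl\<close>) and the blocks (\<open>Inr\<close>).\<close>

definition incidence_graph :: "'a set \<Rightarrow> 'a set set \<Rightarrow> ('a + 'a set) pair_pre_digraph" where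
  "incidence_graph P Bs =
     \<lparr> pverts = Inl ` P \<union> Inr ` Bs,
       parcs = {(Inl p, Inr B) | p B. p \<in> P \<and> B \<in> Bs \<and> p \<in> B} \<union>
               {(Inr B, Inl p) | p B. p \<in> P \<and> B \<in> Bs \<and> p \<in> B} \<rparr>"

definition neighbourhood :: "'v pair_pre_digraph \<Rightarrow> 'v set \<Rightarrow> 'v set" where
  "neighbourhood G S = {w \<in> pverts G. w \<notin> S \<and> (\<exists>u\<in>S. u \<rightarrow>\<^bsub>with_proj G\<^esub> w)}"

lemma pair_graph_incidence_graph:
  assumes "two_design v k \<Lambda> P Bs"
  shows "pair_graph (incidence_graph P Bs)"
proof -
  have "finite P" "Bs \<subseteq> Pow P"
    using assms by (auto simp: two_design_def)
  then have fin: "finite (pverts (incidence_graph P Bs))"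
    by (auto simp: incidence_graph_def dest: finite_subset)
  have "parcs (incidence_graph P Bs)
        \<subseteq> pverts (incidence_graph P Bs) \<times> pverts (incidence_graph P Bs)"
    by (auto simp: incidence_graph_def)
  with fin have "finite (parcs (incidence_graph P Bs))"
    by (meson finite_SigmaI finite_subset)
  with fin show ?thesis
    by unfold_locales
      (auto simp: incidence_graph_def symmetric_def with_proj_def arcs_ends_def arc_to_ends_def
            intro!: symI)
qed

end

(* Double counting gives the first two moments of |B Int X| over the blocks B, namely
   sum |B Int X| = r |X| and sum |B Int X|^2 = r |X| + lambda |X| (|X| - 1), where only the blocks
   of N(X) contribute. The first inequality (with its equality case) is the sum of
   (|B Int X| - m) (|B Int X| - m - 1) >= 0 over N(X), and the second is Cauchy-Schwarz.
   The third is the second applied to Z = P - N(Y), because N(Z) avoids Y and hence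
   |N(Z)| <= b - |Y|. For the fourth, let Z = P - (X Un N(Y)): each of the lambda blocks through a
   pair in X x Z lies in N(X) - Y, and a block contains at most k^2/4 such pairs by AM-GM. *)

theory Submission
  imports Defs "HOL-Analysis.Convex"
begin

section \<open>Double counting of blocks through pairs of points\<close>

locale two_design_rep =
  fixes v k \<Lambda> r :: nat and P :: "'a set" and Bs :: "'a set set"
  assumes design: "two_design v k \<Lambda> P Bs"
    and rep: "\<And>p. p \<in> P \<Longrightarrow> card {B \<in> Bs. p \<in> B} = r"
begin

lemma params: "0 < \<Lambda>" "\<Lambda> < k" "k < v" "card P = v"
  and finite_points: "finite P"
  and block_subset: "B \<in> Bs \<Longrightarrow> B \<subseteq> P"
  and card_block: "B \<in> Bs \<Longrightarrow> card B = k"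
  using design by (auto simp: two_design_def)

lemma finite_blocks: "finite Bs"
  using block_subset finite_points by (meson PowI finite_Pow_iff finite_subset subsetI)

lemma finite_block: "B \<in> Bs \<Longrightarrow> finite B"
  using block_subset finite_points finite_subset by blast

lemma card_blocks_through_pair:
  assumes "x \<in> P" "z \<in> P"
  shows "card {B \<in> Bs. x \<in> B \<and> z \<in> B} = (if x = z then r else \<Lambda>)"
proof (cases "x = z")
  case False
  then have "card {x, z} = 2" "{x, z} \<subseteq> P"
    using assms by auto
  then have "card {B \<in> Bs. {x, z} \<subseteq> B} = \<Lambda>"
    using design unfolding two_design_def by blast
  with False show ?thesis by simp
qed (use assms rep in auto)

text \<open>Counts triples (x, z, B) with x in X, z in Z and both in B, grouped by the pair (x, z).
  All later counts are instances: Z = P gives the first moment, Z = X the second, and disjoint X and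
  Z the fourth inequality.\<close>

lemma sum_inter_product:
  assumes "X \<subseteq> P" "Z \<subseteq> P"
  shows "(\<Sum>B\<in>Bs. real (card (B \<inter> X)) * real (card (B \<inter> Z)))
           = (real r - real \<Lambda>) * real (card (X \<inter> Z)) + real \<Lambda> * real (card X) * real (card Z)"
proof -
  have fin: "finite X" "finite Z"
    using assms finite_points finite_subset by blast+
  have ind: "real (card (B \<inter> S)) = (\<Sum>x\<in>S. of_bool (x \<in> B))" if "finite S" for B S :: "'a set"
    using that by (simp add: Int_commute of_bool_def sum.If_cases)
  have "(\<Sum>B\<in>Bs. real (card (B \<inter> X)) * real (card (B \<inter> Z)))
      = (\<Sum>B\<in>Bs. \<Sum>x\<in>X. \<Sum>z\<in>Z. of_bool (x \<in> B) * of_bool (z \<in> B))"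
    unfolding ind[OF fin(1)] ind[OF fin(2)] sum_product ..
  also have "\<dots> = (\<Sum>x\<in>X. \<Sum>B\<in>Bs. \<Sum>z\<in>Z. of_bool (x \<in> B) * of_bool (z \<in> B))"
    by (rule sum.swap)
  also have "\<dots> = (\<Sum>x\<in>X. \<Sum>z\<in>Z. \<Sum>B\<in>Bs. of_bool (x \<in> B) * of_bool (z \<in> B))"
    by (intro sum.cong refl sum.swap)
  \<comment> \<open>A pair lies in r blocks if x = z and in \<Lambda> blocks otherwise; writing this
    as an affine expression in the indicator of x = z separates the diagonal from the constant
    part.\<close>
  also have "\<dots> = (\<Sum>x\<in>X. \<Sum>z\<in>Z. (real r - real \<Lambda>) * of_bool (x = z) + real \<Lambda>)"
  proof (intro sum.cong refl)
    fix x z assume "x \<in> X" "z \<in> Z"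
    have "(\<Sum>B\<in>Bs. of_bool (x \<in> B) * of_bool (z \<in> B)) = real (card {B \<in> Bs. x \<in> B \<and> z \<in> B})"
      by (simp add: finite_blocks Int_def flip: of_bool_conj)
    also have "\<dots> = (real r - real \<Lambda>) * of_bool (x = z) + real \<Lambda>"
      using card_blocks_through_pair[of x z] \<open>x \<in> X\<close> \<open>z \<in> Z\<close> assms
      by (simp add: subset_iff)
    finally show "(\<Sum>B\<in>Bs. of_bool (x \<in> B) * of_bool (z \<in> B))
        = (real r - real \<Lambda>) * of_bool (x = z) + real \<Lambda>" .
  qed
  also have "\<dots> = (real r - real \<Lambda>) * (\<Sum>x\<in>X. of_bool (x \<in> Z))
      + real \<Lambda> * real (card X) * real (card Z)"
    by (simp add: sum.distrib fin of_bool_def sum.delta' flip: sum_distrib_left)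
  also have "(\<Sum>x\<in>X. of_bool (x \<in> Z)) = real (card (X \<inter> Z))"
    using ind[OF fin(1), of Z] by (simp add: Int_commute)
  finally show ?thesis .
qed

section \<open>Identities between the parameters\<close>

lemma rk_eq: "real r * real k = real r - real \<Lambda> + real \<Lambda> * real v"
proof -
  obtain p where p: "p \<in> P"
    using params by fastforce
  have "real r * real k = (\<Sum>B | B \<in> Bs \<and> p \<in> B. real k)"
    using rep[OF p] by simp
  \<comment> \<open>The first factor is the indicator of p in B and the second is k, so
    \<open>sum_inter_product\<close> applies with X = {p} and Z = P. The outcome is the classical
    r(k - 1) = \<Lambda>(v - 1).\<close>
  also have "\<dots> = (\<Sum>B\<in>Bs. real (card (B \<inter> {p})) * real (card (B \<inter> P)))"
    using block_subset card_block
    by (intro sum.mono_neutral_cong_left finite_blocks) (auto simp: Int_absorb2)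
  finally show ?thesis
    using sum_inter_product[of "{p}" P] p params by simp
qed

text \<open>With Z = P every block gets weight k, and \<open>rk_eq\<close> turns the right-hand side
  into a multiple of k as well; k then cancels.\<close>

lemma sum_inter:
  assumes "X \<subseteq> P"
  shows "(\<Sum>B\<in>Bs. real (card (B \<inter> X))) = real r * real (card X)"
proof -
  have "real k * (\<Sum>B\<in>Bs. real (card (B \<inter> X)))
      = (\<Sum>B\<in>Bs. real (card (B \<inter> X)) * real (card (B \<inter> P)))"
    unfolding sum_distrib_left using block_subset card_block
    by (intro sum.cong) (auto simp: Int_absorb2)
  also have "\<dots> = (real r - real \<Lambda> + real \<Lambda> * real v) * real (card X)"
    using sum_inter_product[OF assms order_refl] assms params
    by (simp add: Int_absorb2 algebra_simps)
  also have "\<dots> = real k * (real r * real (card X))"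
    by (simp flip: rk_eq)
  finally show ?thesis
    using params by simp
qed

lemma bk_eq: "real (card Bs) * real k = real v * real r"
proof -
  have "(\<Sum>B\<in>Bs. real (card (B \<inter> P))) = (\<Sum>B\<in>Bs. real k)"
    using block_subset card_block by (intro sum.cong) (auto simp: Int_absorb2)
  then show ?thesis
    using sum_inter[of P] params by (simp add: mult.commute)
qed

lemma index_less_rep: "\<Lambda> < r"
proof -
  have "(real r - real \<Lambda>) * (real k - 1) = real \<Lambda> * (real v - real k)"
    using rk_eq by (simp add: algebra_simps)
  also have "\<dots> > 0"
    using params by simp
  finally show ?thesis
    using params by (simp add: zero_less_mult_iff)
qed

text \<open>The subtraction is real, so n = 0 gives r - \<Lambda>; this case is why the strict bound
  \<open>index_less_rep\<close> enters.\<close>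

lemma denominator_pos:
  fixes n :: nat
  shows "real r + real \<Lambda> * (real n - 1) > 0"
proof -
  have "real r + real \<Lambda> * (real n - 1)
      = (real r - real \<Lambda>) + real \<Lambda> * real n"
    by (simp add: algebra_simps)
  also have "\<dots> > 0"
    using index_less_rep by (intro add_pos_nonneg) auto
  finally show ?thesis .
qed

section \<open>Moments of the intersection sizes over N(X)\<close>

definition meeting :: "'a set \<Rightarrow> 'a set set" where
  "meeting X = {B \<in> Bs. B \<inter> X \<noteq> {}}"

lemma meeting_subset: "meeting X \<subseteq> Bs"
  by (auto simp: meeting_def)

text \<open>Blocks missing X do not affect the moments, but they would affect the number of
  summands, which has to be |N(X)| in the first two inequalities.\<close>

lemma sum_meeting:
  "(\<And>B. B \<in> Bs \<Longrightarrow> B \<inter> X = {} \<Longrightarrow> f B = 0) \<Longrightarrow> sum f (meeting X) = sum f Bs"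
  by (rule sum.mono_neutral_left[OF finite_blocks meeting_subset]) (auto simp: meeting_def)

lemma sum_meeting_inter:
  assumes "X \<subseteq> P"
  shows "(\<Sum>B\<in>meeting X. real (card (B \<inter> X))) = real r * real (card X)"
  using sum_inter[OF assms] by (simp add: sum_meeting)

lemma sum_meeting_inter_square:
  assumes "X \<subseteq> P"
  shows "(\<Sum>B\<in>meeting X. (real (card (B \<inter> X)))\<^sup>2)
           = (real r + real \<Lambda> * (real (card X) - 1)) * real (card X)"
  using sum_inter_product[OF assms assms]
  by (simp add: sum_meeting power2_eq_square algebra_simps)

section \<open>The first inequality and its equality case\<close>

lemma sum_meeting_consecutive:
  assumes "X \<subseteq> P"
  shows "(\<Sum>B\<in>meeting X. (real (card (B \<inter> X)) - real m) * (real (card (B \<inter> X)) - (real m + 1)))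
           = real (card (meeting X)) * (real m * (real m + 1))
             - (2 * real r * real m - real \<Lambda> * (real (card X) - 1)) * real (card X)"
proof -
  have "(\<Sum>B\<in>meeting X. (real (card (B \<inter> X)) - real m) * (real (card (B \<inter> X)) - (real m + 1)))
      = (\<Sum>B\<in>meeting X. (real (card (B \<inter> X)))\<^sup>2 - (2 * real m + 1) * real (card (B \<inter> X))
          + real m * (real m + 1))"
    by (simp add: power2_eq_square algebra_simps)
  also have "\<dots> = (\<Sum>B\<in>meeting X. (real (card (B \<inter> X)))\<^sup>2)
      - (2 * real m + 1) * (\<Sum>B\<in>meeting X. real (card (B \<inter> X)))
      + real (card (meeting X)) * (real m * (real m + 1))"
    by (simp add: sum.distrib sum_subtractf sum_distrib_left)
  also have "\<dots> = real (card (meeting X)) * (real m * (real m + 1))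
      - (2 * real r * real m - real \<Lambda> * (real (card X) - 1)) * real (card X)"
    unfolding sum_meeting_inter[OF assms] sum_meeting_inter_square[OF assms]
    by (simp add: algebra_simps)
  finally show ?thesis .
qed

lemma card_meeting_ge_consecutive:
  assumes "X \<subseteq> P" "m > 0"
  shows "real (card (meeting X))
           \<ge> (2 * real r * real m - real \<Lambda> * (real (card X) - 1)) / (real m * (real m + 1))
               * real (card X)"
proof -
  \<comment> \<open>No integer lies strictly between m and m + 1, so the two factors never have
    opposite signs.\<close>
  have "0 \<le> (real n - real m) * (real n - (real m + 1))" for n :: nat
  proof (cases "n \<le> m")
    case False
    then have "real n \<ge> real m + 1" by linarith
    then show ?thesis by simp
  qed (simp add: mult_nonpos_nonpos)
  then have "0 \<le> (\<Sum>B\<in>meeting X.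
      (real (card (B \<inter> X)) - real m) * (real (card (B \<inter> X)) - (real m + 1)))"
    by (intro sum_nonneg)
  then have "(2 * real r * real m - real \<Lambda> * (real (card X) - 1)) * real (card X)
      \<le> real (card (meeting X)) * (real m * (real m + 1))"
    unfolding sum_meeting_consecutive[OF assms(1)] by linarith
  moreover have "real m * (real m + 1) > 0"
    using assms(2) by simp
  ultimately show ?thesis
    unfolding times_divide_eq_left by (simp only: pos_divide_le_eq)
qed

lemma card_meeting_eq_consecutive:
  assumes "X \<subseteq> P" "m > 0"
    and "\<And>B. B \<in> meeting X \<Longrightarrow> card (B \<inter> X) = m \<or> card (B \<inter> X) = m + 1"
  shows "real (card (meeting X))
           = (2 * real r * real m - real \<Lambda> * (real (card X) - 1)) / (real m * (real m + 1))
               * real (card X)"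
proof -
  have "(\<Sum>B\<in>meeting X.
      (real (card (B \<inter> X)) - real m) * (real (card (B \<inter> X)) - (real m + 1))) = 0"
    using assms(3) by (intro sum.neutral) fastforce
  then have "real (card (meeting X)) * (real m * (real m + 1))
      = (2 * real r * real m - real \<Lambda> * (real (card X) - 1)) * real (card X)"
    unfolding sum_meeting_consecutive[OF assms(1)] by linarith
  moreover have "real m * (real m + 1) \<noteq> 0"
    using assms(2) by simp
  ultimately show ?thesis
    unfolding times_divide_eq_left by (metis nonzero_eq_divide_eq)
qed

section \<open>The second inequality\<close>

lemma card_meeting_times_ge:
  assumes "X \<subseteq> P"
  shows "(real r)\<^sup>2 * real (card X)
           \<le> real (card (meeting X)) * (real r + real \<Lambda> * (real (card X) - 1))"
\<comment> \<open>Cauchy-Schwarz yields the claim multiplied by |X|, which can be cancelled only if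
  X is nonempty.\<close>
proof (cases "card X = 0")
  case True
  then show ?thesis using index_less_rep by simp
next
  case False
  have "(\<Sum>B\<in>meeting X. real (card (B \<inter> X)))\<^sup>2
      \<le> real (card (meeting X)) * (\<Sum>B\<in>meeting X. (real (card (B \<inter> X)))\<^sup>2)"
    using sum_squared_le_sum_of_squares[of "\<lambda>B. real (card (B \<inter> X))" "meeting X"]
    by (simp add: mult.commute)
  then have "((real r)\<^sup>2 * real (card X)) * real (card X)
      \<le> (real (card (meeting X)) * (real r + real \<Lambda> * (real (card X) - 1))) * real (card X)"
    unfolding sum_meeting_inter[OF assms] sum_meeting_inter_square[OF assms]
    by (simp add: power2_eq_square algebra_simps)
  then show ?thesis
    using False by simp
qed

text \<open>The quotient form of \<open>card_meeting_times_ge\<close>. The product form is kept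
  separately because the third inequality replaces its factor |N(X)| by an upper bound.\<close>

lemma card_meeting_ge:
  assumes "X \<subseteq> P"
  shows "real (card (meeting X))
           \<ge> (real r)\<^sup>2 / (real r + real \<Lambda> * (real (card X) - 1)) * real (card X)"
  using card_meeting_times_ge[OF assms] denominator_pos[of "card X"]
  by (simp add: pos_divide_le_eq)

section \<open>The third inequality\<close>

lemma card_covered_ge:
  assumes "Y \<subseteq> Bs"
  shows "real (card (\<Union>Y))
           \<ge> (real r * real k) / ((real r)\<^sup>2 - real \<Lambda> * (real (card Bs) - real (card Y)))
               * real (card Y)"
proof -
  define Z where "Z = P - \<Union>Y"
  define c where "c = real (card Bs) - real (card Y)"
  define D where "D = (real r)\<^sup>2 - real \<Lambda> * c"
  have sub: "\<Union>Y \<subseteq> P"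
    using assms block_subset by blast
  have cardZ: "real (card Z) = real v - real (card (\<Union>Y))"
    unfolding Z_def using card_Diff_subset[OF finite_subset[OF sub finite_points] sub]
      card_mono[OF finite_points sub] params by simp
  have "meeting Z \<subseteq> Bs - Y"
    by (auto simp: meeting_def Z_def)
  then have "card (meeting Z) \<le> card (Bs - Y)"
    by (intro card_mono) (use finite_blocks in auto)
  also have "\<dots> = card Bs - card Y"
    using assms finite_blocks finite_subset by (intro card_Diff_subset) blast+
  finally have le: "real (card (meeting Z)) \<le> c"
    using card_mono[OF finite_blocks assms] unfolding c_def by simp
  have nn: "0 \<le> real r + real \<Lambda> * (real (card Z) - 1)"
    by (rule less_imp_le[OF denominator_pos])
  have "(real r)\<^sup>2 * real (card Z) \<le> c * (real r + real \<Lambda> * (real (card Z) - 1))"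
    using card_meeting_times_ge[of Z] mult_right_mono[OF le nn] by (simp add: Z_def)
  \<comment> \<open>Collecting the terms in |Z| on the left produces the denominator D of the claim.
    The resulting upper bound on |Z| is a lower bound on |N(Y)| = v - |Z|.\<close>
  then have "D * real (card Z) \<le> c * (real r - real \<Lambda>)"
    by (simp add: D_def algebra_simps)
  then have "D * real v - c * (real r - real \<Lambda>) \<le> real (card (\<Union>Y)) * D"
    unfolding cardZ by (simp add: algebra_simps)
  \<comment> \<open>The identities vr = bk and r - \<Lambda> + \<Lambda>v = rk eliminate v and leave
    rk(b - c), where b - c = |Y|.\<close>
  moreover have "D * real v - c * (real r - real \<Lambda>) = real r * real k * real (card Y)"
  proof -
    have "D * real v - c * (real r - real \<Lambda>)
        = real r * (real v * real r) - c * (real r - real \<Lambda> + real \<Lambda> * real v)"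
      by (simp add: D_def power2_eq_square algebra_simps)
    also have "\<dots> = real r * (real (card Bs) * real k) - c * (real r * real k)"
      by (simp only: bk_eq rk_eq)
    finally show ?thesis
      by (simp add: c_def algebra_simps)
  qed
  \<comment> \<open>Since c is at most b, it suffices that r^2 - \<Lambda>b is positive; multiplied
    by k it equals r(r - \<Lambda>).\<close>
  moreover have "D > 0"
  proof -
    have "(real r)\<^sup>2 * real k - real \<Lambda> * (real (card Bs) * real k)
        = real r * (real r * real k - real \<Lambda> * real v)"
      unfolding bk_eq by (simp add: power2_eq_square algebra_simps)
    also have "\<dots> = real r * (real r - real \<Lambda>)"
      unfolding rk_eq by simp
    also have "\<dots> > 0"
      using index_less_rep by simp
    finally have "0 < ((real r)\<^sup>2 - real \<Lambda> * real (card Bs)) * real k"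
      by (simp add: algebra_simps)
    then have "0 < (real r)\<^sup>2 - real \<Lambda> * real (card Bs)"
      by (simp add: zero_less_mult_iff)
    also have "\<dots> \<le> D"
      by (simp add: D_def c_def algebra_simps)
    finally show ?thesis .
  qed
  ultimately have "real r * real k / D * real (card Y) \<le> real (card (\<Union>Y))"
    by (simp add: pos_divide_le_eq)
  then show ?thesis
    by (simp only: D_def c_def)
qed

section \<open>The fourth inequality\<close>

lemma card_meeting_diff_ge:
  assumes "X \<subseteq> P"
  shows "real (card (meeting X - Y))
           \<ge> 4 * real \<Lambda> / (real k)\<^sup>2 * real (card X) * real (card (P - (X \<union> \<Union>Y)))"
proof -
  define Z where "Z = P - (X \<union> \<Union>Y)"
  have sub: "Z \<subseteq> P" and disj: "X \<inter> Z = {}"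
    by (auto simp: Z_def)
  have amgm: "real (card (B \<inter> X)) * real (card (B \<inter> Z)) \<le> (real k)\<^sup>2 / 4" if "B \<in> Bs" for B
  proof -
    have "card (B \<inter> X) + card (B \<inter> Z) = card ((B \<inter> X) \<union> (B \<inter> Z))"
      using finite_block[OF that] disj by (subst card_Un_disjoint) auto
    also have "\<dots> \<le> k"
      using card_mono[OF finite_block[OF that]] card_block[OF that] by (metis Int_lower1 Un_least)
    finally have "real (card (B \<inter> X)) + real (card (B \<inter> Z)) \<le> real k"
      by linarith
    \<comment> \<open>For the two intersection sizes s and t, 4st = (s + t)^2 - (s - t)^2, which is
      at most k^2.\<close>
    then have "(real (card (B \<inter> X)) + real (card (B \<inter> Z)))\<^sup>2 \<le> (real k)\<^sup>2"
      by (intro power_mono) auto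
    moreover have "0 \<le> (real (card (B \<inter> X)) - real (card (B \<inter> Z)))\<^sup>2"
      by simp
    ultimately show ?thesis
      by (simp add: power2_sum power2_diff)
  qed
  \<comment> \<open>X and Z are disjoint, so the diagonal term of \<open>sum_inter_product\<close>
    vanishes.\<close>
  have "real \<Lambda> * real (card X) * real (card Z)
      = (\<Sum>B\<in>Bs. real (card (B \<inter> X)) * real (card (B \<inter> Z)))"
    using sum_inter_product[OF assms sub] disj by simp
  \<comment> \<open>A block outside N(X) misses X, and a block of Y misses Z because Z avoids the
    union of Y.\<close>
  also have "\<dots> = (\<Sum>B\<in>meeting X - Y. real (card (B \<inter> X)) * real (card (B \<inter> Z)))"
  proof (rule sum.mono_neutral_right[OF finite_blocks])
    show "\<forall>B\<in>Bs - (meeting X - Y). real (card (B \<inter> X)) * real (card (B \<inter> Z)) = 0"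
    proof
      fix B assume "B \<in> Bs - (meeting X - Y)"
      then have "B \<inter> X = {} \<or> B \<inter> Z = {}"
        by (auto simp: meeting_def Z_def)
      then show "real (card (B \<inter> X)) * real (card (B \<inter> Z)) = 0"
        by auto
    qed
  qed (use meeting_subset in auto)
  also have "\<dots> \<le> real (card (meeting X - Y)) * ((real k)\<^sup>2 / 4)"
    by (rule sum_bounded_above) (use meeting_subset amgm in auto)
  finally have "4 * real \<Lambda> * real (card X) * real (card Z)
      \<le> real (card (meeting X - Y)) * (real k)\<^sup>2"
    by simp
  moreover have "(real k)\<^sup>2 > 0"
    using params by simp
  ultimately show ?thesis
    unfolding times_divide_eq_left Z_def[symmetric] by (simp only: pos_divide_le_eq)
qed

section \<open>Translation to the incidence graph\<close>

lemma neighbourhood_points: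
  assumes "X \<subseteq> P"
  shows "neighbourhood (incidence_graph P Bs) (Inl ` X) = Inr ` meeting X"
  using assms
  by (auto simp: neighbourhood_def incidence_graph_def with_proj_def arcs_ends_def
      arc_to_ends_def meeting_def image_iff)

text \<open>Blocks are adjacent to points only, and \<open>block_subset\<close> makes every point of
  a block a vertex, so the whole union is reached.\<close>

lemma neighbourhood_blocks:
  assumes "Y \<subseteq> Bs"
  shows "neighbourhood (incidence_graph P Bs) (Inr ` Y) = Inl ` \<Union>Y"
  using assms block_subset
  by (auto simp: neighbourhood_def incidence_graph_def with_proj_def arcs_ends_def
      arc_to_ends_def image_iff Bex_def) blast+

end

theorem theorem2p1:
  fixes P :: "'a set" and Bs :: "'a set set"
    and v k \<Lambda> b r m :: nat
    and X :: "'a set" and Y :: "'a set set"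
  defines "N \<equiv> neighbourhood (incidence_graph P Bs)"
  assumes design: "two_design v k \<Lambda> P Bs"
    and b: "card Bs = b"
    and r: "\<forall>p\<in>P. card {B \<in> Bs. p \<in> B} = r"
    and m: "m > 0"
    and X: "X \<subseteq> P"
    and Y: "Y \<subseteq> Bs"
  shows "real (card (N (Inl ` X)))
           \<ge> (2 * real r * real m - real \<Lambda> * (real (card X) - 1)) / (real m * (real m + 1))
               * real (card X)
       \<and> real (card (N (Inl ` X)))
           \<ge> (real r)^2 / (real r + real \<Lambda> * (real (card X) - 1)) * real (card X)
       \<and> real (card (N (Inr ` Y)))
           \<ge> (real r * real k) / ((real r)^2 - real \<Lambda> * (real b - real (card Y))) * real (card Y)
       \<and> real (card (N (Inl ` X) - Inr ` Y))
           \<ge> 4 * real \<Lambda> / (real k)^2 * real (card X)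
               * real (card (Inl ` P - (Inl ` X \<union> N (Inr ` Y))))
       \<and> ((\<forall>B. Inr B \<in> N (Inl ` X) \<longrightarrow> card (B \<inter> X) = m \<or> card (B \<inter> X) = m + 1) \<longrightarrow>
            real (card (N (Inl ` X)))
              = (2 * real r * real m - real \<Lambda> * (real (card X) - 1)) / (real m * (real m + 1))
                  * real (card X))"
proof -
  interpret two_design_rep v k \<Lambda> r P Bs
    using design r by unfold_locales auto
  have NX: "N (Inl ` X) = Inr ` meeting X" and NY: "N (Inr ` Y) = Inl ` \<Union>Y"
    unfolding N_def using neighbourhood_points[OF X] neighbourhood_blocks[OF Y] by auto
  \<comment> \<open>\<open>Inl\<close> and \<open>Inr\<close> are injective, so they preserve
    cardinalities and commute with set differences.\<close>
  have cards: "card (N (Inl ` X)) = card (meeting X)" "card (N (Inr ` Y)) = card (\<Union>Y)"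
    "card (N (Inl ` X) - Inr ` Y) = card (meeting X - Y)"
    "card (Inl ` P - (Inl ` X \<union> N (Inr ` Y)) :: ('a + 'a set) set) = card (P - (X \<union> \<Union>Y))"
    unfolding NX NY image_Un[symmetric]
    by (simp_all add: card_image image_set_diff[symmetric])
  have "card (B \<inter> X) = m \<or> card (B \<inter> X) = m + 1"
    if "\<forall>B. Inr B \<in> N (Inl ` X) \<longrightarrow> card (B \<inter> X) = m \<or> card (B \<inter> X) = m + 1" "B \<in> meeting X" for B
    using that by (simp add: NX)
  then show ?thesis
    unfolding cards b[symmetric]
    using card_meeting_ge_consecutive[OF X m] card_meeting_ge[OF X] card_covered_ge[OF Y]
      card_meeting_diff_ge[OF X] card_meeting_eq_consecutive[OF X m]
    by blast
qed

end
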